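(* Let $\mathcal O\subseteq\mathbb C$ be a subring containing $1$ and $A\in\mathrm{GL}_2(\mathcal O)$. (a) If $\mathrm{Roots}(A)=\{\beta,\beta^*\}$ with $\beta\neq\beta^*$, and $A$ has corresponding eigenvectors $v(\beta),v(\beta^* )$, then $\overline{\mathrm{PCF}}_{\mathcal O}(A)=\overline{\mathrm{PCF}}_{\mathcal O}(\beta)\cap\overline{\mathrm{PCF}}_{\mathcal O}(\beta^* )$, and the values of the characters $\lambda_\beta\circ\overline E$ and $\lambda_{\beta^*}\circ\overline E$ on $\overline{\mathrm{PCF}}_{\mathcal O}(A)$ are quadratic integral over $\mathcal O$ and lie in $\mathcal O[\beta]^\times$; the product of these two characters is $\det\circ\overline E$. (b) If $\mathrm{Roots}(A)$ has one element $\beta$ of multiplicity $2$, then $\overline{\mathrm{PCF}}_{\mathcal O}(A)$ has the character $\lambda_\beta\circ\overline E$, whose square is $\det\circ\overline E$. (c) Otherwise $A$ is a scalar multiple of the identity, and $\overline{\mathrm{PCF}}_{\mathcal O}(A)$ has a character $\lambda\circ\overline E$ equal to $\lambda_\beta\circ\overline E$ for every $\beta\in\mathbb P^1(\mathbb C)$, whose square is $\det\circ\overline E$.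
   Context: For $\beta\in\mathbb P^1(\mathbb C)$ let $v(\beta)=(\beta,1)^T$ if $\beta\ne\infty$ and $v(\infty)=(1,0)^T$; $\mathrm{GL}_2(\mathbb C)$ acts on $\mathbb P^1(\mathbb C)$ by linear fractional transformations. For $M=(m_{ij})$, $\mathrm{Quad}(M)=m_{21}X^2+(m_{22}-m_{11})X-m_{12}$ and $\mathrm{Roots}(M)$ is its multiset of roots in $\mathbb P^1(\mathbb C)$ (degree-$1$ polynomials have $\infty$ as a simple root, nonzero constants have a double root at $\infty$). $T(\beta)=\{M\in\mathrm{GL}_2(\mathbb C):M\beta=\beta\}$, and $\lambda_\beta:T(\beta)\to\mathbb C^\times$ sends $M$ to the eigenvalue of $M$ on $v(\beta)$. For $Q\in\mathcal O[X]$ of degree $\le2$, $G(Q)=\{M\in\mathrm{GL}_2(\mathbb C):\mathrm{Quad}(M)=\lambda Q\text{ for some }\lambda\in\mathbb C\}$. PCFs: a PCF over $\mathcal O$ of type $(N,k)$ is $P=[b_1,\dots,b_N,\overline{a_1,\dots,a_k}]$, $b_i,a_i\in\mathcal O$. With $D(x)=\begin{bmatrix}x&1\\1&0\end{bmatrix}$, $E(P)=BAB^{-1}$, $B=D(b_1)\cdots D(b_N)$, $A_P=D(a_1)\cdots D(a_k)$ (so $E(P)=BA_PB^{-1}\in\mathrm{SL}_2^\pm(\mathcal O)$, the matrices in $\mathrm{GL}_2(\mathcal O)$ of determinant $\pm1$). Equivalence: on finite words over $\mathcal O$, $\sim$ is generated by $u[x,0,y]v\sim u[x+y]v$; $\mathsf{SF}(P)=[b_1,\dots,b_N,a_1,\dots,a_k,0,-b_N,\dots,-b_1,0]$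 ($N>0$) or $[a_1,\dots,a_k]$ ($N=0$); $P\sim P'$ iff $\mathsf{SF}(P)\sim\mathsf{SF}(P')$. $\overline{\mathrm{PCF}}(\mathcal O)$ is the set of classes, a group under $\overline P\star\overline{P'}=$ class of the purely periodic CF with repeating block $\mathsf{SF}(P)\mathsf{SF}(P')$; $E$ induces a homomorphism $\overline E:\overline{\mathrm{PCF}}(\mathcal O)\to\mathrm{SL}_2^\pm(\mathcal O)$. Set $\overline{\mathrm{PCF}}_{\mathcal O}(\beta)=\{\overline P:\overline E(\overline P)\beta=\beta\}$ and $\overline{\mathrm{PCF}}_{\mathcal O}(A)=\{\overline P:\overline E(\overline P)\in G(\mathrm{Quad}(A))\}$; these are subgroups, and for $\beta\in\mathrm{Roots}(A)$, $\lambda_\beta\circ\overline E$ is a multiplicative character on $\overline{\mathrm{PCF}}_{\mathcal O}(A)$. *)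

theory Defs
  imports
    "HOL-Analysis.Analysis"
    "HOL-Computational_Algebra.Computational_Algebra"
    "HOL-Algebra.Generated_Rings"
    "HOL-Algebra.Algebraic_Closure_Type"
begin

abbreviation CC :: "complex ring" where
  "CC \<equiv> ring_of_type_algebra"

definition GL2 :: "complex set \<Rightarrow> (complex^2^2) set" where
  "GL2 R = {M. (\<forall>i j. M $ i $ j \<in> R) \<and>
     (\<exists>N. (\<forall>i j. N $ i $ j \<in> R) \<and> M ** N = mat 1 \<and> N ** M = mat 1)}"


section \<open>The projective line\<close>

datatype p1 = Fin complex | Infty

fun pvec :: "p1 \<Rightarrow> complex^2" where
  "pvec (Fin z) = vector [z, 1]"
| "pvec Infty = vector [1, 0]"

fun moebius_act :: "complex^2^2 \<Rightarrow> p1 \<Rightarrow> p1" where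
  "moebius_act M (Fin z) =
     (if M$2$1 * z + M$2$2 = 0 then Infty
      else Fin ((M$1$1 * z + M$1$2) / (M$2$1 * z + M$2$2)))"
| "moebius_act M Infty =
     (if M$2$1 = 0 then Infty else Fin (M$1$1 / M$2$1))"

definition Stab :: "p1 \<Rightarrow> (complex^2^2) set" where
  "Stab \<beta> = {M \<in> GL2 UNIV. moebius_act M \<beta> = \<beta>}"

text \<open>Only meaningful for \<open>M \<in> Stab \<beta>\<close>.\<close>

definition eigval :: "p1 \<Rightarrow> complex^2^2 \<Rightarrow> complex" where
  "eigval \<beta> M = (THE c. M *v pvec \<beta> = c *s pvec \<beta>)"


section \<open>The quadratic polynomial of a matrix\<close>

definition Quad :: "complex^2^2 \<Rightarrow> complex poly" where
  "Quad M = [: - (M$1$2), M$2$2 - M$1$1, M$2$1 :]"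

text \<open>
  A polynomial of degree \<open>d \<le> 2\<close> is regarded as a binary quadratic form, so that
  \<open>\<infinity>\<close> is a root of multiplicity \<open>2 - d\<close>. The roots of the zero polynomial (all points of the
  projective line) do not form a finite multiset; the empty multiset stands for this case. It is
  not the multiset of roots of any other matrix, since those have exactly two elements.
\<close>

definition Roots :: "complex^2^2 \<Rightarrow> p1 multiset" where
  "Roots M = (if Quad M = 0 then {#}
     else image_mset Fin (proots (Quad M)) +
          replicate_mset (2 - Polynomial.degree (Quad M)) Infty)"

definition GQ :: "complex poly \<Rightarrow> (complex^2^2) set" where
  "GQ Q = {M \<in> GL2 UNIV. \<exists>l. Quad M = Polynomial.smult l Q}"


section \<open>Periodic continued fractions\<close>

text \<open>
  The pair \<open>(bs, as)\<close> is the periodic continued fraction with initial part \<open>bs\<close> (possibly empty)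
  and repeating block \<open>as\<close> (nonempty).
\<close>

type_synonym pcf = "complex list \<times> complex list"

definition PCF :: "complex set \<Rightarrow> pcf set" where
  "PCF R = {(bs, as). set bs \<subseteq> R \<and> set as \<subseteq> R \<and> as \<noteq> []}"

definition D :: "complex \<Rightarrow> complex^2^2" where
  "D x = vector [vector [x, 1], vector [1, 0]]"

definition Dprod :: "complex list \<Rightarrow> complex^2^2" where
  "Dprod xs = foldr (**) (map D xs) (mat 1)"

fun E :: "pcf \<Rightarrow> complex^2^2" where
  "E (bs, as) = Dprod bs ** Dprod as ** matrix_inv (Dprod bs)"

inductive word_step :: "complex set \<Rightarrow> complex list \<Rightarrow> complex list \<Rightarrow> bool" for R where
  "set u \<subseteq> R \<Longrightarrow> set v \<subseteq> R \<Longrightarrow> x \<in> R \<Longrightarrow> y \<in> R \<Longrightarrow>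
     word_step R (u @ [x, 0, y] @ v) (u @ [x + y] @ v)"

definition word_equiv :: "complex set \<Rightarrow> complex list \<Rightarrow> complex list \<Rightarrow> bool" where
  "word_equiv R = equivclp (word_step R)"

fun SF :: "pcf \<Rightarrow> complex list" where
  "SF (bs, as) = (if bs = [] then as else bs @ as @ [0] @ map uminus (rev bs) @ [0])"

definition pcf_rel :: "complex set \<Rightarrow> (pcf \<times> pcf) set" where
  "pcf_rel R = {(P, P'). P \<in> PCF R \<and> P' \<in> PCF R \<and> word_equiv R (SF P) (SF P')}"

text \<open>
  The neutral element is the class of the purely periodic continued fraction with block \<open>[0, 0]\<close>:
  \<open>[0, 0, a] \<sim> [a]\<close> for every \<open>a\<close>. Products are formed from arbitrary representatives; all
  choices give the same class.
\<close>

definition PCF_group :: "complex set \<Rightarrow> pcf set monoid" where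
  "PCF_group R =
     \<lparr>carrier = PCF R // pcf_rel R,
      monoid.mult = (\<lambda>p q. \<Union>P\<in>p. \<Union>P'\<in>q. pcf_rel R `` {([], SF P @ SF P')}),
      one = pcf_rel R `` {([], [0, 0])}\<rparr>"

text \<open>\<open>E\<close> is constant on every class.\<close>

definition Ebar :: "pcf set \<Rightarrow> complex^2^2" where
  "Ebar p = the_elem (E ` p)"

definition PCF_pt :: "complex set \<Rightarrow> p1 \<Rightarrow> pcf set set" where
  "PCF_pt R \<beta> = {p \<in> carrier (PCF_group R). moebius_act (Ebar p) \<beta> = \<beta>}"

definition PCF_mat :: "complex set \<Rightarrow> complex^2^2 \<Rightarrow> pcf set set" where
  "PCF_mat R A = {p \<in> carrier (PCF_group R). Ebar p \<in> GQ (Quad A)}"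

text \<open>
  A multiplicative character is a homomorphism to the multiplicative group of \<open>\<complex>\<close>;
  \<open>group_hom\<close> includes the requirement that the domain, with the operation of
  \<open>PCF_group R\<close>, is a group.
\<close>

definition PCF_char :: "complex set \<Rightarrow> complex^2^2 \<Rightarrow> (pcf set \<Rightarrow> complex) \<Rightarrow> bool" where
  "PCF_char R A f \<longleftrightarrow>
     group_hom (PCF_group R\<lparr>carrier := PCF_mat R A\<rparr>) (units_of CC) f"


section \<open>Values of characters\<close>

text \<open>\<open>R[\<beta>]\<close>, with the convention \<open>R[\<infinity>] = R\<close>.\<close>

definition adjoin :: "complex set \<Rightarrow> p1 \<Rightarrow> complex set" where
  "adjoin R \<beta> = generate_ring CC (R \<union> {z. \<beta> = Fin z})"

definition ring_units :: "complex set \<Rightarrow> complex set" where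
  "ring_units S = Units (CC\<lparr>carrier := S\<rparr>)"

text \<open>
  A root of a monic quadratic polynomial over \<open>R\<close>; the polynomial may be reducible.
\<close>

definition quadratic_integral :: "complex set \<Rightarrow> complex \<Rightarrow> bool" where
  "quadratic_integral R x \<longleftrightarrow>
     (\<exists>p. (\<forall>i. Polynomial.coeff p i \<in> R) \<and> Polynomial.degree p = 2 \<and>
          Polynomial.lead_coeff p = 1 \<and> poly p x = 0)"

end

theory Submission
  imports Defs
begin

text \<open>
  Every element of \<open>PCF_group R\<close> is the class of a nonempty word over \<open>R\<close>, multiplication is
  concatenation, and \<open>Ebar\<close> sends the class of \<open>w\<close> to \<open>Dprod w\<close>, because
  \<open>Dprod bs\<close> is inverted by \<open>[0, -b\<^sub>N, \<dots>, -b\<^sub>1, 0]\<close>. If \<open>\<beta>, \<beta>'\<close> are the roots of \<open>Quad A\<close> as a binary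
  form, a matrix \<open>M \<in> GQ (Quad A)\<close> has both as fixed points, and their eigenvalues have sum
  \<open>M$1$1 + M$2$2\<close> and product \<open>det M\<close> (also if \<open>\<beta> = \<beta>'\<close>). Since one eigenvalue is
  \<open>M$2$1 * \<beta> + M$2$2\<close> (or \<open>M$1$1\<close> if \<open>\<beta> = \<infinity>\<close>) and the determinant is \<open>\<plusminus>1\<close>,
  integrality and invertibility follow.
\<close>

no_notation fps_nth (infixl \<open>$\<close> 75)

section \<open>Matrices of size two\<close>

lemma mat2_eq_iff:
  fixes M N :: "'a^2^2"
  shows "M = N \<longleftrightarrow> M$1$1 = N$1$1 \<and> M$1$2 = N$1$2 \<and> M$2$1 = N$2$1 \<and> M$2$2 = N$2$2"
  by (auto simp: vec_eq_iff forall_2)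

lemma mat2_mult_entries:
  fixes M N :: "'a::semiring_1^2^2"
  shows "(M ** N)$i$j = M$i$1 * N$1$j + M$i$2 * N$2$j"
  by (simp add: matrix_matrix_mult_def sum_2)

lemma mat2_one_entries:
  fixes c :: "'a::zero"
  shows "(mat c :: 'a^2^2)$1$1 = c" "(mat c :: 'a^2^2)$1$2 = 0"
    "(mat c :: 'a^2^2)$2$1 = 0" "(mat c :: 'a^2^2)$2$2 = c"
  by (simp_all add: mat_def)

text \<open>\<open>matrix_inv\<close> is a choice among two-sided inverses; associativity leaves
  only one candidate.\<close>

lemma matrix_inv_unique:
  fixes M N :: "'a::semiring_1^'n^'n"
  assumes "M ** N = mat 1" "N ** M = mat 1"
  shows "matrix_inv M = N"
  unfolding matrix_inv_def
proof (rule some_equality)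
  fix N'
  assume "M ** N' = mat 1 \<and> N' ** M = mat 1"
  then show "N' = N"
    using assms by (metis matrix_mul_assoc matrix_mul_lid matrix_mul_rid)
qed (use assms in simp)

lemma GL2_UNIV_iff: "M \<in> GL2 UNIV \<longleftrightarrow> det M \<noteq> 0"
  by (auto simp: GL2_def invertible_det_nz[symmetric] invertible_def)

section \<open>Matrices whose quadratic form is a multiple of \<open>Quad A\<close>\<close>

lemma Quad_eq_smult_iff:
  "Quad M = Polynomial.smult l (Quad A) \<longleftrightarrow>
     M$1$2 = l * A$1$2 \<and> M$2$2 - M$1$1 = l * (A$2$2 - A$1$1) \<and> M$2$1 = l * A$2$1"
  by (auto simp: Quad_def)

text \<open>\<open>Quad M = Polynomial.smult l (Quad A)\<close> says that \<open>M\<close> is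
  \<open>l\<close> times \<open>A\<close> plus a scalar matrix. Such matrices form the algebra
  spanned by \<open>A\<close> and the identity, which is closed under products since the square of
  \<open>A\<close> lies in it.\<close>

lemma GQ_mult:
  assumes "M \<in> GQ (Quad A)" "N \<in> GQ (Quad A)"
  shows "M ** N \<in> GQ (Quad A)"
proof -
  obtain l k where "Quad M = Polynomial.smult l (Quad A)" "Quad N = Polynomial.smult k (Quad A)"
    using assms by (auto simp: GQ_def)
  then have M: "M$1$2 = l * A$1$2" "M$2$1 = l * A$2$1" "M$2$2 = M$1$1 + l * (A$2$2 - A$1$1)"
    and N: "N$1$2 = k * A$1$2" "N$2$1 = k * A$2$1" "N$2$2 = N$1$1 + k * (A$2$2 - A$1$1)"
    unfolding Quad_eq_smult_iff by (simp_all add: diff_eq_eq)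
  \<comment> \<open>The factor is read off from the entry \<open>(M ** N)$2$1\<close>, in which
    \<open>A$2$1\<close> can be pulled out.\<close>
  have "Quad (M ** N) = Polynomial.smult (l * N$1$1 + k * M$2$2) (Quad A)"
    unfolding Quad_eq_smult_iff mat2_mult_entries by (simp add: M N algebra_simps)
  moreover have "M ** N \<in> GL2 UNIV"
    using assms by (simp add: GQ_def GL2_UNIV_iff det_mul)
  ultimately show ?thesis
    by (auto simp: GQ_def)
qed

lemma GQ_one: "mat 1 \<in> GQ (Quad A)"
  by (auto simp: GQ_def GL2_UNIV_iff Quad_def mat2_one_entries intro!: exI[of _ 0])

text \<open>Cramer's rule: \<open>N\<close> is the adjugate of \<open>M\<close> divided by the
  determinant. For each entry, the two equations from one row of \<open>N ** M = mat 1\<close> are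
  combined so that the other entry of that row cancels.\<close>

lemma mat2_left_inverse_entries:
  fixes M N :: "'a::field^2^2"
  assumes "N ** M = mat 1"
  shows "N$1$1 = M$2$2 / det M" "N$1$2 = - M$1$2 / det M"
    "N$2$1 = - M$2$1 / det M" "N$2$2 = M$1$1 / det M"
proof -
  have NM: "N$1$1 * M$1$1 + N$1$2 * M$2$1 = 1" "N$1$1 * M$1$2 + N$1$2 * M$2$2 = 0"
    "N$2$1 * M$1$1 + N$2$2 * M$2$1 = 0" "N$2$1 * M$1$2 + N$2$2 * M$2$2 = 1"
    using assms by (auto simp: mat2_eq_iff mat2_mult_entries mat2_one_entries)
  have "det M \<noteq> 0"
    using assms by (metis det_I det_mul mult_zero_right zero_neq_one)
  moreover have
    "N$1$1 * det M = M$2$2 * (N$1$1 * M$1$1 + N$1$2 * M$2$1) - M$2$1 * (N$1$1 * M$1$2 + N$1$2 * M$2$2)"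
    "N$1$2 * det M = M$1$1 * (N$1$1 * M$1$2 + N$1$2 * M$2$2) - M$1$2 * (N$1$1 * M$1$1 + N$1$2 * M$2$1)"
    "N$2$1 * det M = M$2$2 * (N$2$1 * M$1$1 + N$2$2 * M$2$1) - M$2$1 * (N$2$1 * M$1$2 + N$2$2 * M$2$2)"
    "N$2$2 * det M = M$1$1 * (N$2$1 * M$1$2 + N$2$2 * M$2$2) - M$1$2 * (N$2$1 * M$1$1 + N$2$2 * M$2$1)"
    by (simp_all only: det_2) (simp_all add: algebra_simps)
  ultimately show "N$1$1 = M$2$2 / det M" "N$1$2 = - M$1$2 / det M"
    "N$2$1 = - M$2$1 / det M" "N$2$2 = M$1$1 / det M"
    unfolding NM by (simp_all add: eq_divide_eq del: divide_minus_left)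
qed

text \<open>Passing to the adjugate changes the sign of \<open>Quad\<close>, and the inverse is the
  adjugate divided by \<open>det M\<close>; hence the factor \<open>- l / det M\<close>.\<close>

lemma GQ_left_inverse:
  assumes "M \<in> GQ (Quad A)" "N ** M = mat 1"
  shows "N \<in> GQ (Quad A)"
proof -
  obtain l where "Quad M = Polynomial.smult l (Quad A)"
    using assms by (auto simp: GQ_def)
  then have M: "M$1$2 = l * A$1$2" "M$2$1 = l * A$2$1" "M$2$2 = M$1$1 + l * (A$2$2 - A$1$1)"
    unfolding Quad_eq_smult_iff by (simp_all add: diff_eq_eq)
  have "Quad N = Polynomial.smult (- l / det M) (Quad A)"
    unfolding Quad_eq_smult_iff mat2_left_inverse_entries[OF assms(2)]
    by (simp add: M diff_divide_distrib[symmetric])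
  moreover have "N \<in> GL2 UNIV"
    using assms(2) by (auto simp: GL2_UNIV_iff) (metis det_I det_mul mult_zero_left zero_neq_one)
  ultimately show ?thesis
    unfolding GQ_def by blast
qed


section \<open>Fixed points and eigenvalues\<close>

text \<open>The linear form with root \<open>\<beta>\<close>, dehomogenized, so that the form of \<open>\<infinity>\<close> is constant.\<close>

fun root_factor :: "p1 \<Rightarrow> complex poly" where
  "root_factor (Fin z) = [:- z, 1:]"
| "root_factor Infty = 1"

text \<open>The only possible eigenvalue on \<open>pvec \<beta>\<close>, read off in the coordinate
  where \<open>pvec \<beta>\<close> is \<open>1\<close>: the second for a finite point, the first
  for \<open>Infty\<close>. Unlike \<open>eigval\<close> it is an explicit expression in the entries
  of \<open>M\<close>.\<close>

fun fixed_eigval :: "p1 \<Rightarrow> complex^2^2 \<Rightarrow> complex" where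
  "fixed_eigval (Fin z) M = M$2$1 * z + M$2$2"
| "fixed_eigval Infty M = M$1$1"

lemma pvec_nonzero: "pvec \<beta> \<noteq> 0"
  by (cases \<beta>) (auto simp: vec_eq_iff forall_2)

lemma eigval_eq:
  assumes "M *v pvec \<beta> = c *s pvec \<beta>"
  shows "eigval \<beta> M = c"
  unfolding eigval_def
proof (rule the_equality)
  show "M *v pvec \<beta> = c *s pvec \<beta>"
    by (rule assms)
  fix d
  assume "M *v pvec \<beta> = d *s pvec \<beta>"
  then show "d = c"
    using assms pvec_nonzero[of \<beta>] by (metis vector_mul_rcancel)
qed

lemma eigval_mult:
  assumes "M *v pvec \<beta> = c *s pvec \<beta>" "N *v pvec \<beta> = d *s pvec \<beta>"
  shows "eigval \<beta> (M ** N) = eigval \<beta> M * eigval \<beta> N"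
proof -
  have "(M ** N) *v pvec \<beta> = (c * d) *s pvec \<beta>"
    by (simp add: matrix_vector_mul_assoc[symmetric] assms matrix_vector_mult_scaleR vector_scalar_commute
        vector_smult_assoc mult.commute)
  then show ?thesis
    by (simp add: eigval_eq[OF assms(1)] eigval_eq[OF assms(2)] eigval_eq)
qed

lemma eigval_nonzero:
  assumes "M *v pvec \<beta> = c *s pvec \<beta>" "M \<in> GL2 UNIV"
  shows "eigval \<beta> M \<noteq> 0"
proof
  assume "eigval \<beta> M = 0"
  then have "M *v pvec \<beta> = 0"
    using assms(1) eigval_eq[OF assms(1)] by simp
  moreover obtain N where "N ** M = mat 1"
    using assms(2) by (auto simp: GL2_def)
  ultimately have "pvec \<beta> = 0"
    by (metis matrix_vector_mul_assoc matrix_vector_mul_lid matrix_vector_mult_0_right)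
  then show False
    by (simp add: pvec_nonzero)
qed

text \<open>The action takes the ratio of the coordinates of \<open>M *v pvec \<beta>\<close>, so a
  fixed point is a line that \<open>M\<close> preserves.\<close>

lemma moebius_act_eq_iff:
  assumes "M \<in> GL2 UNIV"
  shows "moebius_act M \<beta> = \<beta> \<longleftrightarrow> M *v pvec \<beta> = fixed_eigval \<beta> M *s pvec \<beta>"
proof (cases \<beta>)
  case (Fin z)
  \<comment> \<open>If the denominator vanished, the equation for the first coordinate would put
    \<open>pvec (Fin z)\<close> into the kernel of \<open>M\<close>, although \<open>M\<close> is
    invertible. So the branch of \<open>moebius_act\<close> with value \<open>Infty\<close> does not
    occur for an eigenvector.\<close>
  have "M$2$1 * z + M$2$2 \<noteq> 0" if "M$1$1 * z + M$1$2 = (M$2$1 * z + M$2$2) * z"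
  proof
    assume "M$2$1 * z + M$2$2 = 0"
    with that have "M$2$2 = - (M$2$1 * z)" "M$1$2 = - (M$1$1 * z)"
      by (simp_all add: eq_neg_iff_add_eq_0 add.commute)
    then have "det M = 0"
      by (simp add: det_2)
    with assms show False
      by (simp add: GL2_UNIV_iff)
  qed
  then show ?thesis
    using Fin by (auto simp: vec_eq_iff forall_2 matrix_vector_mult_def sum_2 field_simps)
next
  case Infty
  then show ?thesis
    by (auto simp: vec_eq_iff forall_2 matrix_vector_mult_def sum_2)
qed

text \<open>Comparing coefficients expresses \<open>M\<close> through \<open>l\<close>, the roots
  and a diagonal entry; what remains are polynomial identities. Only \<open>\<beta>\<close> is
  treated as an eigenvector here: the hypothesis is symmetric in the two points, so exchanging them
  gives the other half.\<close>

lemma Quad_two_roots_aux: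
  assumes "Quad M = Polynomial.smult l (root_factor \<beta> * root_factor \<beta>')"
  shows "M *v pvec \<beta> = fixed_eigval \<beta> M *s pvec \<beta> \<and>
    fixed_eigval \<beta> M + fixed_eigval \<beta>' M = M$1$1 + M$2$2 \<and>
    fixed_eigval \<beta> M * fixed_eigval \<beta>' M = det M"
proof (cases \<beta>; cases \<beta>')
  fix z w
  assume [simp]: "\<beta> = Fin z" "\<beta>' = Fin w"
  have "M$2$1 = l" "M$1$2 = - (l * z * w)" "M$1$1 = M$2$2 + l * (z + w)"
    using assms by (auto simp: Quad_def algebra_simps neg_eq_iff_add_eq_0 eq_neg_iff_add_eq_0)
  then show ?thesis
    by (simp add: vec_eq_iff forall_2 matrix_vector_mult_def sum_2 det_2 algebra_simps)
next
  fix z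
  assume [simp]: "\<beta> = Fin z" "\<beta>' = Infty"
  have "M$2$1 = 0" "M$1$2 = l * z" "M$2$2 = M$1$1 + l"
    using assms by (auto simp: Quad_def algebra_simps)
  then show ?thesis
    by (simp add: vec_eq_iff forall_2 matrix_vector_mult_def sum_2 det_2 algebra_simps)
next
  fix z
  assume [simp]: "\<beta> = Infty" "\<beta>' = Fin z"
  have "M$2$1 = 0" "M$1$2 = l * z" "M$2$2 = M$1$1 + l"
    using assms by (auto simp: Quad_def algebra_simps)
  then show ?thesis
    by (simp add: vec_eq_iff forall_2 matrix_vector_mult_def sum_2 det_2 algebra_simps)
next
  assume [simp]: "\<beta> = Infty" "\<beta>' = Infty"
  have "M$2$1 = 0" "M$1$1 = M$2$2"
    using assms by (auto simp: Quad_def one_pCons algebra_simps)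
  then show ?thesis
    by (simp add: vec_eq_iff forall_2 matrix_vector_mult_def sum_2 det_2 algebra_simps)
qed

lemma Quad_two_roots:
  assumes "Quad M = Polynomial.smult l (root_factor \<beta> * root_factor \<beta>')"
  shows "M *v pvec \<beta> = fixed_eigval \<beta> M *s pvec \<beta>"
    and "M *v pvec \<beta>' = fixed_eigval \<beta>' M *s pvec \<beta>'"
    and "fixed_eigval \<beta> M + fixed_eigval \<beta>' M = M$1$1 + M$2$2"
    and "fixed_eigval \<beta> M * fixed_eigval \<beta>' M = det M"
  using Quad_two_roots_aux[OF assms] Quad_two_roots_aux[of M l \<beta>' \<beta>] assms
  by (simp_all add: mult.commute)

text \<open>Both points are roots of \<open>Quad M\<close> as a binary form, and two distinct roots
  determine such a form up to a factor. The factor is \<open>0\<close> when \<open>M\<close> is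
  scalar.\<close>

lemma Quad_of_two_fixed_points:
  assumes "M *v pvec \<beta> = fixed_eigval \<beta> M *s pvec \<beta>"
    and "M *v pvec \<beta>' = fixed_eigval \<beta>' M *s pvec \<beta>'" and "\<beta> \<noteq> \<beta>'"
  obtains l where "Quad M = Polynomial.smult l (root_factor \<beta> * root_factor \<beta>')"
proof (cases \<beta>; cases \<beta>')
  fix z w
  assume [simp]: "\<beta> = Fin z" "\<beta>' = Fin w"
  have M: "M$1$2 = (M$2$1 * z + M$2$2) * z - M$1$1 * z" "M$1$2 = (M$2$1 * w + M$2$2) * w - M$1$1 * w"
    using assms by (simp_all add: vec_eq_iff forall_2 matrix_vector_mult_def sum_2 algebra_simps)
  \<comment> \<open>Subtracting the two expressions for \<open>M$1$2\<close> produces the factor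
    \<open>z - w\<close>; cancelling it gives the relation for the sum of the roots.\<close>
  have "(z - w) * (M$2$2 + M$2$1 * (z + w) - M$1$1) =
    ((M$2$1 * z + M$2$2) * z - M$1$1 * z) - ((M$2$1 * w + M$2$2) * w - M$1$1 * w)"
    by (simp add: algebra_simps)
  also have "\<dots> = 0"
    unfolding M[symmetric] by simp
  finally have "M$1$1 = M$2$2 + M$2$1 * (z + w)"
    using assms(3) by simp
  then have "Quad M = Polynomial.smult (M$2$1) (root_factor \<beta> * root_factor \<beta>')"
    unfolding Quad_def M(1) by (simp add: algebra_simps)
  then show thesis
    by (rule that)
next
  fix z
  assume [simp]: "\<beta> = Fin z" "\<beta>' = Infty"
  have "M$2$1 = 0" "M$1$2 = M$2$2 * z - M$1$1 * z"
    using assms by (simp_all add: vec_eq_iff forall_2 matrix_vector_mult_def sum_2 eq_diff_eq add.commute)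
  then have "Quad M = Polynomial.smult (M$2$2 - M$1$1) (root_factor \<beta> * root_factor \<beta>')"
    by (simp add: Quad_def algebra_simps)
  then show thesis
    by (rule that)
next
  fix z
  assume [simp]: "\<beta> = Infty" "\<beta>' = Fin z"
  have "M$2$1 = 0" "M$1$2 = M$2$2 * z - M$1$1 * z"
    using assms by (simp_all add: vec_eq_iff forall_2 matrix_vector_mult_def sum_2 eq_diff_eq add.commute)
  then have "Quad M = Polynomial.smult (M$2$2 - M$1$1) (root_factor \<beta> * root_factor \<beta>')"
    by (simp add: Quad_def algebra_simps)
  then show thesis
    by (rule that)
qed (use assms in simp)

section \<open>The multiset of roots on the projective line\<close>

lemma degree_Quad_le: "Polynomial.degree (Quad M) \<le> 2"
  by (simp add: Quad_def)

text \<open>A nonzero complex polynomial has as many roots as its degree, and the copies of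
  \<open>Infty\<close> make up the difference to \<open>2\<close>.\<close>

lemma size_Roots: "Quad M \<noteq> 0 \<Longrightarrow> size (Roots M) = 2"
  using degree_Quad_le[of M] by (simp add: Roots_def size_proots_complex)

text \<open>The factor of \<open>Infty\<close> is \<open>1\<close>, so this is the factorization of
  a complex polynomial over its finite roots.\<close>

lemma Quad_eq_prod_Roots:
  assumes "Roots M \<noteq> {#}"
  shows "Quad M = Polynomial.smult (Polynomial.lead_coeff (Quad M)) (\<Prod>\<beta>\<in>#Roots M. root_factor \<beta>)"
proof -
  have "(\<Prod>\<beta>\<in>#Roots M. root_factor \<beta>) = (\<Prod>z\<in>#proots (Quad M). [:- z, 1:])"
    using assms by (auto simp: Roots_def image_mset.compositionality o_def)
  then show ?thesis
    by (simp add: complex_poly_decompose_multiset)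
qed

lemma Roots_nonempty_imp_Quad_nonzero: "Roots M \<noteq> {#} \<Longrightarrow> Quad M \<noteq> 0"
  by (auto simp: Roots_def)

lemma Quad_eq_two_roots:
  assumes "Roots A = {#\<beta>, \<beta>'#}"
  obtains l where "l \<noteq> 0" "Quad A = Polynomial.smult l (root_factor \<beta> * root_factor \<beta>')"
proof
  have "Roots A \<noteq> {#}"
    using assms by simp
  then show "Polynomial.lead_coeff (Quad A) \<noteq> 0"
    using Roots_nonempty_imp_Quad_nonzero[of A] by simp
  show "Quad A = Polynomial.smult (Polynomial.lead_coeff (Quad A)) (root_factor \<beta> * root_factor \<beta>')"
    using Quad_eq_prod_Roots[OF \<open>Roots A \<noteq> {#}\<close>] assms by simp
qed

lemma Quad_of_mem_GQ:
  assumes "Roots A = {#\<beta>, \<beta>'#}" and "M \<in> GQ (Quad A)"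
  obtains l where "Quad M = Polynomial.smult l (root_factor \<beta> * root_factor \<beta>')"
proof -
  obtain a where "Quad A = Polynomial.smult a (root_factor \<beta> * root_factor \<beta>')"
    using Quad_eq_two_roots[OF assms(1)] .
  moreover obtain l where "Quad M = Polynomial.smult l (Quad A)"
    using assms(2) by (auto simp: GQ_def)
  ultimately have "Quad M = Polynomial.smult (l * a) (root_factor \<beta> * root_factor \<beta>')"
    by simp
  then show thesis
    by (rule that)
qed

text \<open>This yields the intersection of stabilizers. Conversely to the eigenvector property of
  roots, fixing two distinct points makes \<open>Quad M\<close> a multiple of the product of their
  factors, and so does \<open>Quad A\<close> with a nonzero coefficient \<open>a\<close>, by which
  one can divide.\<close>

lemma mem_GQ_iff_fixes_roots:
  assumes "Roots A = {#\<beta>, \<beta>'#}" and "\<beta> \<noteq> \<beta>'" and "M \<in> GL2 UNIV"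
  shows "M \<in> GQ (Quad A) \<longleftrightarrow> moebius_act M \<beta> = \<beta> \<and> moebius_act M \<beta>' = \<beta>'"
proof
  assume "M \<in> GQ (Quad A)"
  then show "moebius_act M \<beta> = \<beta> \<and> moebius_act M \<beta>' = \<beta>'"
    using Quad_of_mem_GQ[OF assms(1)] Quad_two_roots(1,2) assms(3) by (metis moebius_act_eq_iff)
next
  assume "moebius_act M \<beta> = \<beta> \<and> moebius_act M \<beta>' = \<beta>'"
  then obtain l where l: "Quad M = Polynomial.smult l (root_factor \<beta> * root_factor \<beta>')"
    using Quad_of_two_fixed_points assms(2,3) by (metis moebius_act_eq_iff)
  obtain a where "a \<noteq> 0" "Quad A = Polynomial.smult a (root_factor \<beta> * root_factor \<beta>')"
    using Quad_eq_two_roots[OF assms(1)] .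
  with l have "Quad M = Polynomial.smult (l / a) (Quad A)"
    by simp
  with assms(3) show "M \<in> GQ (Quad A)"
    by (auto simp: GQ_def)
qed

lemma Quad_eq_0_iff: "Quad M = 0 \<longleftrightarrow> M = mat (M$1$1)"
  by (auto simp: Quad_def mat2_eq_iff mat2_one_entries)

lemma scalar_mult_pvec: "mat c *v pvec \<beta> = c *s pvec \<beta>"
  by (simp add: vec_eq_iff forall_2 matrix_vector_mult_def sum_2 mat_def)


section \<open>Words\<close>

text \<open>\<open>D 0\<close> is the swap matrix, its own inverse, and the inverse of
  \<open>D x\<close> is \<open>D (- x)\<close> conjugated by it. In the reversed product the inner
  swaps cancel, which leaves one \<open>0\<close> at each end.\<close>

definition inv_word :: "complex list \<Rightarrow> complex list" where
  "inv_word w = 0 # map uminus (rev w) @ [0]"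

lemma Dprod_append: "Dprod (u @ v) = Dprod u ** Dprod v"
  by (induction u) (auto simp: Dprod_def matrix_mul_assoc)

text \<open>\<open>D x\<close> is the unipotent upper triangular matrix with entry \<open>x\<close>
  times the swap \<open>D 0\<close>. Inserting \<open>D 0\<close> cancels a swap, and the entries of
  unipotent matrices add.\<close>

lemma Dprod_step:
  assumes "word_step R u v"
  shows "Dprod u = Dprod v"
proof -
  have "Dprod [x, 0, y] = Dprod [x + y]" for x y
    by (simp add: Dprod_def mat2_eq_iff mat2_mult_entries D_def)
  with assms show ?thesis
    by cases (simp only: Dprod_append)
qed

lemma Dprod_word_equiv: "word_equiv R u v \<Longrightarrow> Dprod u = Dprod v"
  unfolding word_equiv_def by (induction rule: equivclp_induct) (auto dest: Dprod_step)

lemma word_equiv_refl [simp]: "word_equiv R u u"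
  by (simp add: word_equiv_def)

lemma word_equiv_sym: "word_equiv R u v \<Longrightarrow> word_equiv R v u"
  unfolding word_equiv_def by (rule equivclp_sym)

lemma word_equiv_trans [trans]: "word_equiv R u v \<Longrightarrow> word_equiv R v w \<Longrightarrow> word_equiv R u w"
  unfolding word_equiv_def by (rule equivclp_trans)

lemma word_equiv_step: "word_step R u v \<Longrightarrow> word_equiv R u v"
  unfolding word_equiv_def by blast

lemma word_step_context:
  assumes "word_step R u v" "set s \<subseteq> R" "set t \<subseteq> R"
  shows "word_step R (s @ u @ t) (s @ v @ t)"
  using assms(1)
proof cases
  case (1 a b x y)
  then show ?thesis
    using word_step.intros[of "s @ a" R "b @ t" x y] assms(2,3) by simp
qed

lemma word_equiv_context:
  assumes "word_equiv R u v" "set s \<subseteq> R" "set t \<subseteq> R"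
  shows "word_equiv R (s @ u @ t) (s @ v @ t)"
  using assms(1) unfolding word_equiv_def
proof (induction rule: equivclp_induct)
  case (step y z)
  then show ?case
    using word_step_context[OF _ assms(2,3)] by (meson equivclp_into_equivclp)
qed simp

text \<open>First \<open>u\<close> is replaced in front of \<open>v\<close>, then \<open>v\<close>
  behind \<open>u'\<close>; these two neighbours serve as the contexts.\<close>

lemma word_equiv_append:
  assumes "word_equiv R u u'" "word_equiv R v v'" "set v \<subseteq> R" "set u' \<subseteq> R"
  shows "word_equiv R (u @ v) (u' @ v')"
  using word_equiv_context[OF assms(1), of "[]" v] word_equiv_context[OF assms(2), of u' "[]"] assms(3,4)
  by (auto intro: word_equiv_trans)

section \<open>Nonempty words and their classes\<close>

definition words :: "complex set \<Rightarrow> complex list set" where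
  "words R = {w. set w \<subseteq> R \<and> w \<noteq> []}"

definition word_class :: "complex set \<Rightarrow> complex list \<Rightarrow> pcf set" where
  "word_class R w = pcf_rel R `` {([], w)}"

lemma equiv_pcf_rel: "equiv (PCF R) (pcf_rel R)"
  by (rule equivI)
    (auto simp: refl_on_def sym_def trans_def pcf_rel_def dest: word_equiv_sym intro: word_equiv_trans)

lemma PCF_word: "w \<in> words R \<Longrightarrow> ([], w) \<in> PCF R"
  by (auto simp: words_def PCF_def)

lemma word_class_eq_iff:
  assumes "u \<in> words R" "v \<in> words R"
  shows "word_class R u = word_class R v \<longleftrightarrow> word_equiv R u v"
  unfolding word_class_def
  using eq_equiv_class_iff[OF equiv_pcf_rel PCF_word[OF assms(1)] PCF_word[OF assms(2)]]
  by (simp add: pcf_rel_def PCF_word assms)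

lemma SF_eq: "SF (bs, as) = (if bs = [] then as else bs @ as @ inv_word bs)"
  by (simp add: inv_word_def)

lemma word_class_mem: "w \<in> words R \<Longrightarrow> word_class R w \<in> carrier (PCF_group R)"
  by (auto simp: PCF_group_def word_class_def intro: quotientI PCF_word)

lemma words_append: "u \<in> words R \<Longrightarrow> v \<in> words R \<Longrightarrow> u @ v \<in> words R"
  by (auto simp: words_def)


section \<open>The group of classes\<close>

lemma CC_simps:
  "carrier CC = UNIV" "\<one>\<^bsub>CC\<^esub> = 1" "\<zero>\<^bsub>CC\<^esub> = 0" "x \<otimes>\<^bsub>CC\<^esub> y = x * y" "x \<oplus>\<^bsub>CC\<^esub> y = x + y"
  by (simp_all add: ring_of_type_algebra_def)

lemma ring_CC: "ring CC"
  by (rule ring_from_type_algebra)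

lemma CC_uminus: "\<ominus>\<^bsub>CC\<^esub> x = - x"
proof -
  interpret ring CC by (rule ring_CC)
  show ?thesis
    using minus_equality[of "- x" x] by (simp add: CC_simps)
qed

lemma subring_CC_closed:
  assumes "subring S CC"
  shows "0 \<in> S" "1 \<in> S" "x \<in> S \<Longrightarrow> - x \<in> S" "x \<in> S \<Longrightarrow> y \<in> S \<Longrightarrow> x + y \<in> S"
    "x \<in> S \<Longrightarrow> y \<in> S \<Longrightarrow> x * y \<in> S"
  using subringE[OF assms] by (simp_all add: CC_simps CC_uminus)

locale complex_subring =
  fixes R :: "complex set"
  assumes subring: "subring R CC"
begin

lemmas closed [intro, simp] = subring_CC_closed[OF subring]

lemma inv_word_in_words: "set w \<subseteq> R \<Longrightarrow> inv_word w \<in> words R"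
  by (auto simp: inv_word_def words_def)

text \<open>Cancellation starts in the middle: the last letter \<open>x\<close> of the word meets
  \<open>0\<close> and \<open>- x\<close>, and \<open>[x, 0, - x]\<close> collapses to a single
  \<open>0\<close>. This is the leading \<open>0\<close> of the inverse of the shorter word.\<close>

lemma word_equiv_right_inverse: "set w \<subseteq> R \<Longrightarrow> word_equiv R (w @ inv_word w) [0, 0]"
proof (induction w rule: rev_induct)
  case Nil
  show ?case by (simp add: inv_word_def)
next
  case (snoc x w)
  have "word_step R (w @ [x, 0, - x] @ (map uminus (rev w) @ [0])) (w @ [x + - x] @ (map uminus (rev w) @ [0]))"
    using snoc.prems by (intro word_step.intros) auto
  then show ?case
    using snoc word_equiv_step word_equiv_trans by (fastforce simp: inv_word_def)
qed

text \<open>Here the first letter cancels, and the remaining \<open>0\<close> is the final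
  \<open>0\<close> of the inverse of the shorter word.\<close>

lemma word_equiv_left_inverse: "set w \<subseteq> R \<Longrightarrow> word_equiv R (inv_word w @ w) [0, 0]"
proof (induction w)
  case Nil
  show ?case by (simp add: inv_word_def)
next
  case (Cons x w)
  have "word_step R ((0 # map uminus (rev w)) @ [- x, 0, x] @ w) ((0 # map uminus (rev w)) @ [- x + x] @ w)"
    using Cons.prems by (intro word_step.intros) auto
  then show ?case
    using Cons word_equiv_step word_equiv_trans by (fastforce simp: inv_word_def)
qed

text \<open>The two zeros are absorbed by the first letter, which exists because the word is
  nonempty.\<close>

lemma word_equiv_left_one: "w \<in> words R \<Longrightarrow> word_equiv R ([0, 0] @ w) w"
  using word_step.intros[of "[]" R "tl w" 0 "hd w"]
  by (cases w) (auto simp: words_def intro: word_equiv_step)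

lemma SF_in_words: "P \<in> PCF R \<Longrightarrow> SF P \<in> words R"
  by (cases P) (auto simp: PCF_def words_def)

text \<open>\<open>SF ([], w)\<close> is \<open>w\<close>, so \<open>P\<close> is related to the
  purely periodic \<open>([], SF P)\<close>.\<close>

lemma word_class_SF:
  assumes "P \<in> PCF R"
  shows "pcf_rel R `` {P} = word_class R (SF P)"
  unfolding word_class_def
  by (rule equiv_class_eq[OF equiv_pcf_rel])
    (simp add: pcf_rel_def assms PCF_word[OF SF_in_words])

lemma carrierE:
  assumes "p \<in> carrier (PCF_group R)"
  obtains w where "w \<in> words R" "p = word_class R w"
proof -
  obtain P where "P \<in> PCF R" "p = pcf_rel R `` {P}"
    using assms by (auto simp: PCF_group_def elim: quotientE)
  then show thesis
    using that SF_in_words word_class_SF by metis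
qed

lemma mem_word_class: "w \<in> words R \<Longrightarrow> ([], w) \<in> word_class R w"
  by (simp add: word_class_def pcf_rel_def PCF_word)

text \<open>The product is a union over all pairs of representatives. Every pair contributes the
  same class, because concatenation respects \<open>word_equiv\<close>.\<close>

lemma mult_word_class:
  assumes "u \<in> words R" "v \<in> words R"
  shows "word_class R u \<otimes>\<^bsub>PCF_group R\<^esub> word_class R v = word_class R (u @ v)"
proof -
  have "pcf_rel R `` {([], SF P @ SF P')} = word_class R (u @ v)"
    if "P \<in> word_class R u" "P' \<in> word_class R v" for P P'
  proof -
    have P: "SF P \<in> words R" "SF P' \<in> words R" "word_equiv R u (SF P)" "word_equiv R v (SF P')"
      using that by (auto simp: word_class_def pcf_rel_def intro: SF_in_words)
    then have "word_equiv R (u @ v) (SF P @ SF P')"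
      using assms by (auto intro!: word_equiv_append simp: words_def)
    then show ?thesis
      using P assms by (metis word_class_def word_class_eq_iff words_append)
  qed
  \<comment> \<open>A union of equal sets is that set only if the index sets are nonempty.\<close>
  moreover have "word_class R u \<noteq> {}" "word_class R v \<noteq> {}"
    using mem_word_class assms by blast+
  ultimately show ?thesis
    unfolding PCF_group_def by (simp cong: SUP_cong)
qed

lemma one_PCF_group: "\<one>\<^bsub>PCF_group R\<^esub> = word_class R [0, 0]"
  by (simp add: PCF_group_def word_class_def)

lemma zeros_in_words: "[0, 0] \<in> words R"
  by (simp add: words_def)

text \<open>On words, associativity is that of concatenation, \<open>[0, 0]\<close> is a left unit
  and \<open>inv_word\<close> gives left inverses; these suffice for a group.\<close>

lemma group_PCF: "group (PCF_group R)"
proof (rule groupI)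
  show "\<one>\<^bsub>PCF_group R\<^esub> \<in> carrier (PCF_group R)"
    by (simp add: one_PCF_group word_class_mem zeros_in_words)
  fix p q r
  assume "p \<in> carrier (PCF_group R)"
  then obtain u where u: "u \<in> words R" "p = word_class R u"
    by (rule carrierE)
  show "\<one>\<^bsub>PCF_group R\<^esub> \<otimes>\<^bsub>PCF_group R\<^esub> p = p"
    using u zeros_in_words
    by (simp add: one_PCF_group mult_word_class word_class_eq_iff words_append
        word_equiv_left_one[simplified] words_append[of "[0, 0]", simplified])
  have "set u \<subseteq> R"
    using u by (simp add: words_def)
  then have "inv_word u \<in> words R" "word_class R (inv_word u @ u) = word_class R [0, 0]"
    using u zeros_in_words
    by (simp_all add: inv_word_in_words word_class_eq_iff words_append word_equiv_left_inverse)
  then show "\<exists>y\<in>carrier (PCF_group R). y \<otimes>\<^bsub>PCF_group R\<^esub> p = \<one>\<^bsub>PCF_group R\<^esub>"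
    using u by (intro bexI[of _ "word_class R (inv_word u)"])
      (simp_all add: one_PCF_group mult_word_class word_class_mem)
  assume "q \<in> carrier (PCF_group R)"
  then obtain v where v: "v \<in> words R" "q = word_class R v"
    by (rule carrierE)
  show "p \<otimes>\<^bsub>PCF_group R\<^esub> q \<in> carrier (PCF_group R)"
    using u v by (simp add: mult_word_class word_class_mem words_append)
  assume "r \<in> carrier (PCF_group R)"
  then obtain w where "w \<in> words R" "r = word_class R w"
    by (rule carrierE)
  then show "p \<otimes>\<^bsub>PCF_group R\<^esub> q \<otimes>\<^bsub>PCF_group R\<^esub> r = p \<otimes>\<^bsub>PCF_group R\<^esub> (q \<otimes>\<^bsub>PCF_group R\<^esub> r)"
    using u v by (simp add: mult_word_class words_append)
qed

end


section \<open>The matrix of a class\<close>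

lemma Dprod_zeros: "Dprod [0, 0] = mat 1"
  by (simp add: Dprod_def mat2_eq_iff mat2_mult_entries mat2_one_entries D_def)

lemma matrix_inv_Dprod: "matrix_inv (Dprod w) = Dprod (inv_word w)"
proof -
  \<comment> \<open>The letters of \<open>w\<close> are arbitrary complex numbers here, so the word
    relations are used over the whole field.\<close>
  interpret complex_subring UNIV
    using ring.carrier_is_subring[OF ring_CC] by (intro complex_subring.intro) (simp add: CC_simps)
  show ?thesis
    using Dprod_word_equiv[OF word_equiv_right_inverse[of w]]
      Dprod_word_equiv[OF word_equiv_left_inverse[of w]]
    by (intro matrix_inv_unique) (simp_all add: Dprod_append Dprod_zeros)
qed

lemma E_eq_Dprod_SF: "E P = Dprod (SF P)"
proof (cases P)
  case (Pair bs as)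
  \<comment> \<open>For an empty initial part \<open>SF\<close> appends nothing, whereas
    \<open>inv_word []\<close> is \<open>[0, 0]\<close>; its matrix is trivial, so the two branches
    agree.\<close>
  have "Dprod [] = mat 1" "Dprod (inv_word []) = mat 1"
    by (simp_all add: inv_word_def Dprod_zeros) (simp add: Dprod_def)
  then show ?thesis
    unfolding Pair E.simps SF_eq by (auto simp: matrix_inv_Dprod Dprod_append matrix_mul_assoc)
qed

lemma det_Dprod: "det (Dprod w) = (-1) ^ length w"
  by (induction w) (auto simp: Dprod_def det_mul, simp add: det_2 D_def)

context complex_subring
begin

lemma Dprod_entries: "set w \<subseteq> R \<Longrightarrow> Dprod w $ i $ j \<in> R"
proof (induction w arbitrary: i j)
  case Nil
  show ?case by (simp add: Dprod_def mat_def)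
next
  case (Cons x w)
  have "D x $ i $ j \<in> R" for i j
    using Cons.prems exhaust_2[of i] exhaust_2[of j] by (auto simp: D_def)
  then show ?case
    using Cons by (simp add: Dprod_def mat2_mult_entries)
qed

text \<open>\<open>E\<close> depends only on \<open>SF\<close>, and \<open>Dprod\<close> respects
  \<open>word_equiv\<close>; so the image of a class is a singleton and \<open>the_elem\<close> is
  well defined on it.\<close>

lemma Ebar_word_class:
  assumes "w \<in> words R"
  shows "Ebar (word_class R w) = Dprod w"
proof -
  have "E ` word_class R w = {Dprod w}"
    using mem_word_class[OF assms]
    by (force simp: E_eq_Dprod_SF word_class_def pcf_rel_def dest: Dprod_word_equiv)
  then show ?thesis
    by (simp add: Ebar_def)
qed

lemma Ebar_one: "Ebar \<one>\<^bsub>PCF_group R\<^esub> = mat 1"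
  by (simp add: one_PCF_group Ebar_word_class zeros_in_words Dprod_zeros)

lemma Ebar_mult:
  assumes "p \<in> carrier (PCF_group R)" "q \<in> carrier (PCF_group R)"
  shows "Ebar (p \<otimes>\<^bsub>PCF_group R\<^esub> q) = Ebar p ** Ebar q"
  using assms by (auto elim!: carrierE simp: mult_word_class Ebar_word_class words_append Dprod_append)

lemma Ebar_entries: "p \<in> carrier (PCF_group R) \<Longrightarrow> Ebar p $ i $ j \<in> R"
  by (auto elim!: carrierE simp: Ebar_word_class words_def Dprod_entries)

lemma det_Ebar: "p \<in> carrier (PCF_group R) \<Longrightarrow> det (Ebar p) = 1 \<or> det (Ebar p) = -1"
  by (auto elim!: carrierE simp: Ebar_word_class det_Dprod) (metis neg_one_even_power neg_one_odd_power)

lemma Ebar_GL2: "p \<in> carrier (PCF_group R) \<Longrightarrow> Ebar p \<in> GL2 UNIV"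
  using det_Ebar by (force simp: GL2_UNIV_iff)


section \<open>Characters\<close>

text \<open>\<open>PCF_mat R A\<close> is the preimage of \<open>GQ (Quad A)\<close> under the
  homomorphism \<open>Ebar\<close>.\<close>

lemma subgroup_PCF_mat: "subgroup (PCF_mat R A) (PCF_group R)"
proof -
  interpret G: group "PCF_group R" by (rule group_PCF)
  show ?thesis
  proof (rule G.subgroupI)
    show "PCF_mat R A \<subseteq> carrier (PCF_group R)"
      by (auto simp: PCF_mat_def)
    show "PCF_mat R A \<noteq> {}"
      using GQ_one Ebar_one by (auto simp: PCF_mat_def intro!: exI[of _ "\<one>\<^bsub>PCF_group R\<^esub>"])
    show "p \<otimes>\<^bsub>PCF_group R\<^esub> q \<in> PCF_mat R A" if "p \<in> PCF_mat R A" "q \<in> PCF_mat R A" for p q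
      using that by (simp add: PCF_mat_def Ebar_mult GQ_mult)
    show "inv\<^bsub>PCF_group R\<^esub> p \<in> PCF_mat R A" if "p \<in> PCF_mat R A" for p
    proof -
      have p: "p \<in> carrier (PCF_group R)" "Ebar p \<in> GQ (Quad A)"
        using that by (auto simp: PCF_mat_def)
      have "Ebar (inv\<^bsub>PCF_group R\<^esub> p) ** Ebar p = mat 1"
        using p(1) Ebar_mult[of "inv\<^bsub>PCF_group R\<^esub> p" p] by (simp add: Ebar_one)
      with p show ?thesis
        by (auto simp: PCF_mat_def intro: GQ_left_inverse)
    qed
  qed
qed

text \<open>Shared by all three cases: on a common eigenvector the eigenvalues multiply, and they
  are nonzero because the matrices are invertible.\<close>

lemma PCF_char_eigval:
  assumes "\<And>p. p \<in> PCF_mat R A \<Longrightarrow> \<exists>c. Ebar p *v pvec \<beta> = c *s pvec \<beta>"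
  shows "PCF_char R A (eigval \<beta> \<circ> Ebar)"
proof -
  interpret CC: ring CC by (rule ring_CC)
  have carrier: "p \<in> carrier (PCF_group R)" if "p \<in> PCF_mat R A" for p
    using that by (simp add: PCF_mat_def)
  have "eigval \<beta> (Ebar p) \<in> Units CC" if "p \<in> PCF_mat R A" for p
  proof -
    have "eigval \<beta> (Ebar p) \<noteq> 0"
      using assms[OF that] eigval_nonzero Ebar_GL2 carrier that by blast
    then show ?thesis
      by (auto simp: Units_def CC_simps intro!: exI[of _ "inverse (eigval \<beta> (Ebar p))"])
  qed
  moreover have "eigval \<beta> (Ebar (p \<otimes>\<^bsub>PCF_group R\<^esub> q)) = eigval \<beta> (Ebar p) * eigval \<beta> (Ebar q)"
    if "p \<in> PCF_mat R A" "q \<in> PCF_mat R A" for p q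
    using assms[OF that(1)] assms[OF that(2)] that by (auto simp: Ebar_mult carrier intro: eigval_mult)
  ultimately have "(eigval \<beta> \<circ> Ebar) \<in> hom (PCF_group R\<lparr>carrier := PCF_mat R A\<rparr>) (units_of CC)"
    by (auto simp: hom_def units_of_def CC_simps)
  then show ?thesis
    unfolding PCF_char_def
    using group.subgroup_imp_group[OF group_PCF subgroup_PCF_mat] CC.units_group
    by (simp add: group_hom_def group_hom_axioms_def)
qed

text \<open>The points may coincide, so this serves the double root as well as distinct
  roots.\<close>

lemma PCF_mat_two_roots:
  assumes "Roots A = {#\<beta>, \<beta>'#}" and "p \<in> PCF_mat R A"
  shows "Ebar p *v pvec \<beta> = fixed_eigval \<beta> (Ebar p) *s pvec \<beta>"
    and "Ebar p *v pvec \<beta>' = fixed_eigval \<beta>' (Ebar p) *s pvec \<beta>'"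
    and "Ebar p \<in> Stab \<beta> \<inter> Stab \<beta>'"
    and "eigval \<beta> (Ebar p) + eigval \<beta>' (Ebar p) = Ebar p$1$1 + Ebar p$2$2"
    and "eigval \<beta> (Ebar p) * eigval \<beta>' (Ebar p) = det (Ebar p)"
proof -
  have p: "p \<in> carrier (PCF_group R)" "Ebar p \<in> GQ (Quad A)"
    using assms(2) by (auto simp: PCF_mat_def)
  obtain l where l: "Quad (Ebar p) = Polynomial.smult l (root_factor \<beta> * root_factor \<beta>')"
    using Quad_of_mem_GQ[OF assms(1) p(2)] .
  note fixed = Quad_two_roots[OF l]
  show "Ebar p *v pvec \<beta> = fixed_eigval \<beta> (Ebar p) *s pvec \<beta>"
    "Ebar p *v pvec \<beta>' = fixed_eigval \<beta>' (Ebar p) *s pvec \<beta>'"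
    by (rule fixed)+
  show "Ebar p \<in> Stab \<beta> \<inter> Stab \<beta>'"
    using fixed(1,2) Ebar_GL2[OF p(1)] by (simp add: Stab_def moebius_act_eq_iff)
  show "eigval \<beta> (Ebar p) + eigval \<beta>' (Ebar p) = Ebar p$1$1 + Ebar p$2$2"
    "eigval \<beta> (Ebar p) * eigval \<beta>' (Ebar p) = det (Ebar p)"
    using fixed(3,4) by (simp_all add: eigval_eq[OF fixed(1)] eigval_eq[OF fixed(2)])
qed

section \<open>Integrality and units\<close>

lemma quadratic_integralI:
  assumes "x + y \<in> R" "x * y \<in> R"
  shows "quadratic_integral R x"
  unfolding quadratic_integral_def
proof (intro exI conjI allI)
  \<comment> \<open>This is the monic quadratic with roots \<open>x\<close> and \<open>y\<close>;
    for eigenvalues it is the characteristic polynomial.\<close>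
  let ?p = "[:x * y, - (x + y), 1:]"
  show "Polynomial.coeff ?p i \<in> R" for i
    using assms closed(3)[OF assms(1)] by (auto simp: coeff_pCons split: nat.split)
  show "poly ?p x = 0"
    by (simp add: algebra_simps)
qed simp_all

lemma adjoin_subring: "subring (adjoin R \<beta>) CC"
  unfolding adjoin_def by (rule ring.generate_ring_is_subring[OF ring_CC]) (simp add: CC_simps)

lemma subset_adjoin: "R \<subseteq> adjoin R \<beta>"
  by (auto simp: adjoin_def intro: generate_ring.incl)

text \<open>The inverse of \<open>x\<close> is \<open>y\<close> or \<open>- y\<close>.\<close>

lemma ring_units_adjoinI:
  assumes "x \<in> adjoin R \<beta>" "y \<in> adjoin R \<beta>" "x * y = 1 \<or> x * y = -1"
  shows "x \<in> ring_units (adjoin R \<beta>)"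
proof -
  have "\<exists>z\<in>adjoin R \<beta>. x * z = 1"
    using assms subring_CC_closed(3)[OF adjoin_subring assms(2)] by (metis minus_mult_right minus_minus)
  then show ?thesis
    using assms(1) by (auto simp: ring_units_def Units_def CC_simps mult.commute)
qed

lemma fixed_eigval_in_adjoin:
  assumes "\<And>i j. M $ i $ j \<in> R"
  shows "fixed_eigval \<beta> M \<in> adjoin R \<beta>"
proof (cases \<beta>)
  case (Fin z)
  then have "z \<in> adjoin R \<beta>"
    by (auto simp: adjoin_def intro: generate_ring.incl)
  then show ?thesis
    using Fin subring_CC_closed[OF adjoin_subring] subset_adjoin assms by (auto simp: subset_iff)
next
  case Infty
  then show ?thesis
    using subset_adjoin assms by auto
qed

section \<open>The three cases: distinct roots, a double root, scalar matrices\<close>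

theorem PCF_mat_distinct_roots:
  assumes roots: "Roots A = {#\<beta>, \<beta>'#}" and "\<beta> \<noteq> \<beta>'"
  shows "PCF_mat R A = PCF_pt R \<beta> \<inter> PCF_pt R \<beta>' \<and>
       PCF_char R A (eigval \<beta> \<circ> Ebar) \<and>
       PCF_char R A (eigval \<beta>' \<circ> Ebar) \<and>
       (\<forall>p \<in> PCF_mat R A.
          Ebar p \<in> Stab \<beta> \<inter> Stab \<beta>' \<and>
          quadratic_integral R (eigval \<beta> (Ebar p)) \<and>
          quadratic_integral R (eigval \<beta>' (Ebar p)) \<and>
          eigval \<beta> (Ebar p) \<in> ring_units (adjoin R \<beta>) \<and>
          eigval \<beta>' (Ebar p) \<in> ring_units (adjoin R \<beta>) \<and>
          eigval \<beta> (Ebar p) * eigval \<beta>' (Ebar p) = det (Ebar p))"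
proof (intro conjI ballI)
  show "PCF_mat R A = PCF_pt R \<beta> \<inter> PCF_pt R \<beta>'"
    using mem_GQ_iff_fixes_roots[OF assms Ebar_GL2] by (auto simp: PCF_mat_def PCF_pt_def)
  show "PCF_char R A (eigval \<beta> \<circ> Ebar)" "PCF_char R A (eigval \<beta>' \<circ> Ebar)"
    using PCF_mat_two_roots(1,2)[OF roots] by (blast intro: PCF_char_eigval)+
  fix p
  assume p: "p \<in> PCF_mat R A"
  let ?x = "eigval \<beta> (Ebar p)" and ?y = "eigval \<beta>' (Ebar p)"
  note fixed = PCF_mat_two_roots[OF roots p]
  have carrier: "p \<in> carrier (PCF_group R)"
    using p by (simp add: PCF_mat_def)
  have det: "?x * ?y = 1 \<or> ?x * ?y = -1"
    using det_Ebar[OF carrier] fixed(5) by simp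
  have trace: "?x + ?y \<in> R"
    using fixed(4) Ebar_entries[OF carrier] by simp
  show "Ebar p \<in> Stab \<beta> \<inter> Stab \<beta>'" "?x * ?y = det (Ebar p)"
    using fixed by auto
  show "quadratic_integral R ?x" "quadratic_integral R ?y"
    using quadratic_integralI[of ?x ?y] quadratic_integralI[of ?y ?x] trace det
    by (auto simp: add.commute mult.commute)
  have x: "?x \<in> adjoin R \<beta>"
    using fixed_eigval_in_adjoin[OF Ebar_entries[OF carrier]] by (simp add: eigval_eq[OF fixed(1)])
  \<comment> \<open>The explicit formula for \<open>?y\<close> involves \<open>\<beta>'\<close>. As
    the trace minus \<open>?x\<close>, it lies in the ring generated by \<open>\<beta>\<close>
    too.\<close>
  have "?x + ?y \<in> adjoin R \<beta>"
    using trace subset_adjoin by auto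
  then have "(?x + ?y) + - ?x \<in> adjoin R \<beta>"
    using x subring_CC_closed[OF adjoin_subring] by blast
  then have y: "?y \<in> adjoin R \<beta>"
    by simp
  show "?x \<in> ring_units (adjoin R \<beta>)"
    using ring_units_adjoinI[OF x y det] .
  show "?y \<in> ring_units (adjoin R \<beta>)"
    using ring_units_adjoinI[OF y x] det by (simp add: mult.commute)
qed

text \<open>With both roots equal, the product of the eigenvalues becomes a square.\<close>

theorem PCF_mat_double_root:
  assumes "Roots A = {#\<beta>, \<beta>#}"
  shows "PCF_char R A (eigval \<beta> \<circ> Ebar) \<and>
    (\<forall>p \<in> PCF_mat R A. Ebar p \<in> Stab \<beta> \<and> (eigval \<beta> (Ebar p))\<^sup>2 = det (Ebar p))"
  using PCF_mat_two_roots[OF assms] PCF_char_eigval[of A \<beta>] by (auto simp: power2_eq_square)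

text \<open>Every multiple of \<open>Quad A\<close> vanishes, so each \<open>Ebar p\<close> is
  scalar and has the same eigenvalue at all points. The character is taken at \<open>Infty\<close>,
  an arbitrary choice.\<close>

theorem PCF_mat_scalar:
  assumes "Quad A = 0"
  shows "\<exists>lam. PCF_char R A (lam \<circ> Ebar) \<and>
    (\<forall>p \<in> PCF_mat R A.
       (\<forall>\<beta>. Ebar p \<in> Stab \<beta> \<and> lam (Ebar p) = eigval \<beta> (Ebar p)) \<and>
       (lam (Ebar p))\<^sup>2 = det (Ebar p))"
proof (intro exI[of _ "eigval Infty"] conjI ballI allI)
  have scalar: "Ebar p = mat (Ebar p$1$1)" if "p \<in> PCF_mat R A" for p
    using that assms by (auto simp: PCF_mat_def GQ_def Quad_eq_0_iff[symmetric])
  have eigvec: "Ebar p *v pvec \<beta> = Ebar p$1$1 *s pvec \<beta>" if "p \<in> PCF_mat R A" for p \<beta>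
    using scalar[OF that] scalar_mult_pvec by metis
  show "PCF_char R A (eigval Infty \<circ> Ebar)"
    using eigvec by (blast intro: PCF_char_eigval)
  fix p
  assume p: "p \<in> PCF_mat R A"
  have entries: "Ebar p$1$2 = 0" "Ebar p$2$1 = 0" "Ebar p$2$2 = Ebar p$1$1"
    using scalar[OF p] mat2_one_entries by metis+
  then have "fixed_eigval \<beta> (Ebar p) = Ebar p$1$1" for \<beta>
    by (cases \<beta>) simp_all
  then show "Ebar p \<in> Stab \<beta>" for \<beta>
    using p eigvec[OF p, of \<beta>] Ebar_GL2[of p] by (simp add: Stab_def moebius_act_eq_iff PCF_mat_def)
  show "eigval Infty (Ebar p) = eigval \<beta> (Ebar p)" for \<beta>
    by (simp add: eigval_eq[OF eigvec[OF p]])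
  show "(eigval Infty (Ebar p))\<^sup>2 = det (Ebar p)"
    using entries by (simp add: eigval_eq[OF eigvec[OF p]] det_2 power2_eq_square)
qed

end

section \<open>Exhaustiveness of the cases and conclusion\<close>

lemma Roots_cases:
  obtains (distinct) \<beta> \<beta>' where "Roots A = {#\<beta>, \<beta>'#}" "\<beta> \<noteq> \<beta>'"
  | (double) \<beta> where "Roots A = {#\<beta>, \<beta>#}"
  | (scalar) "Quad A = 0"
proof (cases "Quad A = 0")
  case False
  then have "size (Roots A) = 2"
    by (rule size_Roots)
  then obtain \<beta> N where "Roots A = add_mset \<beta> N" "size N = 1"
    by (metis One_nat_def Suc_1 Suc_inject size_add_mset size_eq_Suc_imp_eq_union)
  moreover from this obtain \<beta>' where "N = {#\<beta>'#}"
    using size_1_singleton_mset by blast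
  ultimately have "Roots A = {#\<beta>, \<beta>'#}"
    by simp
  then show thesis
    using distinct double by (cases "\<beta> = \<beta>'") auto
qed (rule scalar)

text \<open>The factorization of \<open>Quad A\<close> is applied to \<open>A\<close> itself. With
  this, failure of the first two cases can only mean \<open>Quad A = 0\<close>.\<close>

lemma eigenvectors_of_roots:
  assumes "Roots A = {#\<beta>, \<beta>'#}"
  shows "\<exists>c. A *v pvec \<beta> = c *s pvec \<beta>" "\<exists>c. A *v pvec \<beta>' = c *s pvec \<beta>'"
  using Quad_eq_two_roots[OF assms] Quad_two_roots(1,2) by metis+

theorem theorem5p5:
  fixes R :: "complex set" and A :: "complex^2^2"
  assumes "subring R CC" and "A \<in> GL2 R"
  shows
    "(\<forall>\<beta> \<beta>'. Roots A = {#\<beta>, \<beta>'#} \<and> \<beta> \<noteq> \<beta>' \<and>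
         (\<exists>c. A *v pvec \<beta> = c *s pvec \<beta>) \<and> (\<exists>c. A *v pvec \<beta>' = c *s pvec \<beta>') \<longrightarrow>
       PCF_mat R A = PCF_pt R \<beta> \<inter> PCF_pt R \<beta>' \<and>
       PCF_char R A (eigval \<beta> \<circ> Ebar) \<and>
       PCF_char R A (eigval \<beta>' \<circ> Ebar) \<and>
       (\<forall>p \<in> PCF_mat R A.
          Ebar p \<in> Stab \<beta> \<inter> Stab \<beta>' \<and>
          quadratic_integral R (eigval \<beta> (Ebar p)) \<and>
          quadratic_integral R (eigval \<beta>' (Ebar p)) \<and>
          eigval \<beta> (Ebar p) \<in> ring_units (adjoin R \<beta>) \<and>
          eigval \<beta>' (Ebar p) \<in> ring_units (adjoin R \<beta>) \<and>
          eigval \<beta> (Ebar p) * eigval \<beta>' (Ebar p) = det (Ebar p))) \<and>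
     (\<forall>\<beta>. Roots A = {#\<beta>, \<beta>#} \<longrightarrow>
       PCF_char R A (eigval \<beta> \<circ> Ebar) \<and>
       (\<forall>p \<in> PCF_mat R A.
          Ebar p \<in> Stab \<beta> \<and> (eigval \<beta> (Ebar p))\<^sup>2 = det (Ebar p))) \<and>
     (\<not> (\<exists>\<beta> \<beta>'. Roots A = {#\<beta>, \<beta>'#} \<and> \<beta> \<noteq> \<beta>' \<and>
         (\<exists>c. A *v pvec \<beta> = c *s pvec \<beta>) \<and> (\<exists>c. A *v pvec \<beta>' = c *s pvec \<beta>')) \<and>
      \<not> (\<exists>\<beta>. Roots A = {#\<beta>, \<beta>#}) \<longrightarrow>
       (\<exists>c. A = mat c) \<and>
       (\<exists>lam :: complex^2^2 \<Rightarrow> complex.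
          PCF_char R A (lam \<circ> Ebar) \<and>
          (\<forall>p \<in> PCF_mat R A.
             (\<forall>\<beta>. Ebar p \<in> Stab \<beta> \<and> lam (Ebar p) = eigval \<beta> (Ebar p)) \<and>
             (lam (Ebar p))\<^sup>2 = det (Ebar p))))"
proof -
  interpret complex_subring R
    by (rule complex_subring.intro) (rule assms)
  have "Quad A = 0" if "\<nexists>\<beta> \<beta>'. Roots A = {#\<beta>, \<beta>'#} \<and> \<beta> \<noteq> \<beta>' \<and>
         (\<exists>c. A *v pvec \<beta> = c *s pvec \<beta>) \<and> (\<exists>c. A *v pvec \<beta>' = c *s pvec \<beta>')"
      and "\<nexists>\<beta>. Roots A = {#\<beta>, \<beta>#}"
    using that Roots_cases[of A] eigenvectors_of_roots by metis
  then show ?thesis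
    using PCF_mat_distinct_roots PCF_mat_double_root PCF_mat_scalar[of A] Quad_eq_0_iff[of A]
    by (intro conjI allI impI; (elim conjE)?; blast)
qed

end
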